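(* Let $c>0$. Suppose that in \textsc{Multi-price Balance}, for each $i\in[n]$, the random segment borders $\tilde L_i^{(0)},\dots,\tilde L_i^{(m_i)}$ and value function $\tilde\Phi_i$ are initialized so that, with probability $1$, $$k_i\Big(\tilde\Phi_i\big(\tfrac{N+1}{k_i}\big)-\tilde\Phi_i\big(\tfrac{N}{k_i}\big)\Big)+\tilde\Phi_i(\tilde L_i^{(j)})-\tilde\Phi_i\big(\tfrac{N}{k_i}\big)\le\frac{r_i^{(j)}}{c}\quad\text{for all } j\in[m_i],\ N\in\{0,\dots,\tilde L_i^{(j)}k_i-1\},$$ and $$\mathbb E[\tilde\Phi_i(\tilde L_i^{(j)})]\ge r_i^{(j)}\quad\text{for all } j\in[m_i].$$ Then \textsc{Multi-price Balance} achieves a competitive ratio of $c$.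
   Context: Problem. A setup $\mathcal S$ consists of $n\in\mathbb N$ items; item $i\in[n]$ has starting inventory $k_i\in\mathbb N$ and price set $\{r_i^{(1)}<\dots<r_i^{(m_i)}\}$ of positive numbers; $r_i^{(0)}=0$. An arrival sequence $\mathcal A$ consists of $T$ customers and numbers $p^{(j)}_{t,i}\in[0,1]$. Customers arrive in order; on arrival of $t$ the numbers $p^{(j)}_{t,i}$ are revealed, and the firm either offers nothing or offers one item $i$ with remaining inventory at one price $r_i^{(j)}$; the customer accepts with probability $p^{(j)}_{t,i}$ independently, earning $r_i^{(j)}$ and decreasing $i$'s inventory by one. $\mathsf{ALG}(\mathcal S,\mathcal A)$ is the algorithm's random revenue; $\mathsf{OPT}(\mathcal S,\mathcal A)$ is the optimal value of the LP: maximize $\sum_{t,i,j}p^{(j)}_{t,i}r^{(j)}_ix^{(j)}_{t,i}$ s.t. $\sum_{t,j}p^{(j)}_{t,i}x^{(j)}_{t,i}\le k_i$ for all $i$, $\sum_{i,j}x^{(j)}_{t,i}\le1$ for all $t$, $x\ge0$. Achieving competitive ratio $c$ (on a setup $\mathcal S$) means $\mathbb E[\mathsf{ALG}(\mathcal S,\mathcal A)]\ge c\,\mathsf{OPT}(\mathcal S,\mathcal A)$ for all $\mathcal A$. \textsc{Multi-price Balance}: at the start, independently for each item $i$, a randomized procedure produces random $\tilde L_i^{(0)},\dots,\tilde L_i^{(m_i)}\in\{0,\frac1{k_i},\dots,1\}$ with $0=\tilde L_i^{(0)}\le\dots\le\tilde L_i^{(m_i)}=1$, and a random function $\tilde\Phi_i$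 on $\{0,\frac1{k_i},\dots,1\}$ with $0=\tilde\Phi_i(0)\le\tilde\Phi_i(\frac1{k_i})\le\dots\le\tilde\Phi_i(1)$. Let $N_i$ be the number of units of $i$ sold so far (initially $0$). For each customer $t$, if $\max_{i,j}p^{(j)}_{t,i}(\tilde\Phi_i(\tilde L_i^{(j)})-\tilde\Phi_i(N_i/k_i))$ is strictly positive, offer a maximizing item $i$ at a maximizing price $r_i^{(j)}$ (on acceptance, $N_i$ increases by $1$); otherwise offer nothing. *)

theory Defs
  imports "HOL-Probability.Probability"
begin

text \<open>
  Items, prices and customers are numbered from 1, and \<open>price S i 0\<close> is the
  dummy price \<open>0\<close>.
\<close>

record sales_setup =
  items :: nat
  inventory :: "nat \<Rightarrow> nat"
  num_prices :: "nat \<Rightarrow> nat"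
  price :: "nat \<Rightarrow> nat \<Rightarrow> real"

definition valid_setup :: "sales_setup \<Rightarrow> bool" where
  "valid_setup S \<longleftrightarrow> (\<forall>i\<in>{1..items S}.
     1 \<le> inventory S i \<and> 1 \<le> num_prices S i \<and>
     price S i 0 = 0 \<and> (\<forall>j\<in>{1..num_prices S i}. 0 < price S i j) \<and>
     strict_mono_on {1..num_prices S i} (price S i))"

definition offers :: "sales_setup \<Rightarrow> (nat \<times> nat) set" where
  "offers S = (SIGMA i:{1..items S}. {1..num_prices S i})"

text \<open>\<open>accept_prob A t i j\<close> is the probability that customer \<open>t\<close> accepts item \<open>i\<close> at its
  \<open>j\<close>-th price.\<close>

record arrivals =
  customers :: nat
  accept_prob :: "nat \<Rightarrow> nat \<Rightarrow> nat \<Rightarrow> real"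

definition valid_arrivals :: "sales_setup \<Rightarrow> arrivals \<Rightarrow> bool" where
  "valid_arrivals S A \<longleftrightarrow>
     (\<forall>t\<in>{1..customers A}. \<forall>(i, j)\<in>offers S. accept_prob A t i j \<in> {0..1})"

definition lp_feasible :: "sales_setup \<Rightarrow> arrivals \<Rightarrow> (nat \<Rightarrow> nat \<Rightarrow> nat \<Rightarrow> real) \<Rightarrow> bool" where
  "lp_feasible S A x \<longleftrightarrow>
     (\<forall>i\<in>{1..items S}.
        (\<Sum>t=1..customers A. \<Sum>j=1..num_prices S i. accept_prob A t i j * x t i j)
          \<le> real (inventory S i)) \<and>
     (\<forall>t\<in>{1..customers A}. (\<Sum>i=1..items S. \<Sum>j=1..num_prices S i. x t i j) \<le> 1) \<and>
     (\<forall>t\<in>{1..customers A}. \<forall>i\<in>{1..items S}. \<forall>j\<in>{1..num_prices S i}. 0 \<le> x t i j)"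

definition lp_objective :: "sales_setup \<Rightarrow> arrivals \<Rightarrow> (nat \<Rightarrow> nat \<Rightarrow> nat \<Rightarrow> real) \<Rightarrow> real" where
  "lp_objective S A x =
     (\<Sum>t=1..customers A. \<Sum>i=1..items S. \<Sum>j=1..num_prices S i.
        accept_prob A t i j * price S i j * x t i j)"

text \<open>For valid data the feasible region contains \<open>0\<close> and the objective is bounded above on it,
  so this real supremum is the optimal value of the LP.\<close>

definition OPT :: "sales_setup \<Rightarrow> arrivals \<Rightarrow> real" where
  "OPT S A = (SUP x\<in>{x. lp_feasible S A x}. lp_objective S A x)"

text \<open>
  A history lists, most recent customer first, what happened with each past customer:
  \<open>None\<close> if nothing was offered, and \<open>Some (i, j, a)\<close> if item \<open>i\<close> was offered at its \<open>j\<close>-th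
  price, where \<open>a\<close> says whether the customer accepted.
\<close>

type_synonym history = "(nat \<times> nat \<times> bool) option list"

definition sold :: "history \<Rightarrow> nat \<Rightarrow> nat" where
  "sold h i = length (filter (\<lambda>e. \<exists>j. e = Some (i, j, True)) h)"

definition revenue :: "sales_setup \<Rightarrow> history \<Rightarrow> real" where
  "revenue S h =
     (\<Sum>e\<leftarrow>h. case e of None \<Rightarrow> 0 | Some (i, j, a) \<Rightarrow> if a then price S i j else 0)"

text \<open>The distribution of the history after the first \<open>t\<close> customers, when customer \<open>t\<close> is
  offered \<open>\<pi> t h\<close> after history \<open>h\<close>.\<close>

primrec run :: "arrivals \<Rightarrow> (nat \<Rightarrow> history \<Rightarrow> (nat \<times> nat) option) \<Rightarrow> nat \<Rightarrow> history pmf" where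
  "run A \<pi> 0 = return_pmf []"
| "run A \<pi> (Suc t) =
     bind_pmf (run A \<pi> t) (\<lambda>h.
       case \<pi> (Suc t) h of
         None \<Rightarrow> return_pmf (None # h)
       | Some (i, j) \<Rightarrow>
           map_pmf (\<lambda>a. Some (i, j, a) # h) (bernoulli_pmf (accept_prob A (Suc t) i j)))"

definition grid :: "nat \<Rightarrow> real set" where
  "grid k = (\<lambda>N. real N / real k) ` {0..k}"

text \<open>
  The random segment borders \<open>L i \<omega> j\<close> and value functions \<open>\<Phi> i \<omega>\<close> live on a probability
  space \<open>M\<close>. Only the values of \<open>L i \<omega>\<close> on \<open>{0..num_prices S i}\<close> and of \<open>\<Phi> i \<omega>\<close> on the grid
  matter. \<open>indep_vars\<close> states both that these are random variables and that the pairs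
  belonging to different items are independent.
\<close>

definition mpb_initialization ::
  "sales_setup \<Rightarrow> 'w measure \<Rightarrow> (nat \<Rightarrow> 'w \<Rightarrow> nat \<Rightarrow> real) \<Rightarrow> (nat \<Rightarrow> 'w \<Rightarrow> real \<Rightarrow> real) \<Rightarrow> bool" where
  "mpb_initialization S M L \<Phi> \<longleftrightarrow>
     prob_space M \<and>
     prob_space.indep_vars M
       (\<lambda>i. (\<Pi>\<^sub>M j\<in>{0..num_prices S i}. (borel :: real measure)) \<Otimes>\<^sub>M
            (\<Pi>\<^sub>M x\<in>grid (inventory S i). (borel :: real measure)))
       (\<lambda>i \<omega>. (restrict (L i \<omega>) {0..num_prices S i}, restrict (\<Phi> i \<omega>) (grid (inventory S i))))
       {1..items S} \<and>
     (\<forall>i\<in>{1..items S}. \<forall>\<omega>\<in>space M.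
        L i \<omega> ` {0..num_prices S i} \<subseteq> grid (inventory S i) \<and>
        mono_on {0..num_prices S i} (L i \<omega>) \<and>
        L i \<omega> 0 = 0 \<and> L i \<omega> (num_prices S i) = 1 \<and>
        mono_on (grid (inventory S i)) (\<Phi> i \<omega>) \<and>
        \<Phi> i \<omega> 0 = 0)"

text \<open>
  Among several maximizing offers any one may be chosen: the choice may depend on the
  history, on the realized initialization and on further randomness carried by \<open>\<omega>\<close>, but not on
  the acceptance decisions of the current or future customers.
\<close>

definition tie_breaking :: "'w measure \<Rightarrow> ('w \<Rightarrow> history \<Rightarrow> (nat \<times> nat) set \<Rightarrow> nat \<times> nat) \<Rightarrow> bool" where
  "tie_breaking M tie \<longleftrightarrow>
     (\<forall>h C. (\<lambda>\<omega>. tie \<omega> h C) \<in> measurable M (count_space UNIV)) \<and>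
     (\<forall>\<omega>\<in>space M. \<forall>h C. C \<noteq> {} \<longrightarrow> tie \<omega> h C \<in> C)"

text \<open>Below, \<open>L\<close>, \<open>\<Phi>\<close> and \<open>tie\<close> are realized (deterministic) data.\<close>

definition bid ::
  "sales_setup \<Rightarrow> arrivals \<Rightarrow> (nat \<Rightarrow> nat \<Rightarrow> real) \<Rightarrow> (nat \<Rightarrow> real \<Rightarrow> real) \<Rightarrow>
   nat \<Rightarrow> history \<Rightarrow> nat \<times> nat \<Rightarrow> real" where
  "bid S A L \<Phi> t h = (\<lambda>(i, j).
     accept_prob A t i j * (\<Phi> i (L i j) - \<Phi> i (real (sold h i) / real (inventory S i))))"

text \<open>No explicit inventory check is needed: by monotonicity of \<open>\<Phi> i\<close>, a positive bid for item
  \<open>i\<close> forces \<open>sold h i / inventory S i < L i j \<le> 1\<close>.\<close>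

definition mpb_policy ::
  "sales_setup \<Rightarrow> arrivals \<Rightarrow> (nat \<Rightarrow> nat \<Rightarrow> real) \<Rightarrow> (nat \<Rightarrow> real \<Rightarrow> real) \<Rightarrow>
   (history \<Rightarrow> (nat \<times> nat) set \<Rightarrow> nat \<times> nat) \<Rightarrow> nat \<Rightarrow> history \<Rightarrow> (nat \<times> nat) option" where
  "mpb_policy S A L \<Phi> tie t h =
     (let C = {q \<in> offers S. 0 < bid S A L \<Phi> t h q \<and>
                 (\<forall>q'\<in>offers S. bid S A L \<Phi> t h q' \<le> bid S A L \<Phi> t h q)}
      in if C = {} then None else Some (tie h C))"

definition mpb_expected_revenue ::
  "sales_setup \<Rightarrow> 'w measure \<Rightarrow> (nat \<Rightarrow> 'w \<Rightarrow> nat \<Rightarrow> real) \<Rightarrow> (nat \<Rightarrow> 'w \<Rightarrow> real \<Rightarrow> real) \<Rightarrow>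
   ('w \<Rightarrow> history \<Rightarrow> (nat \<times> nat) set \<Rightarrow> nat \<times> nat) \<Rightarrow> arrivals \<Rightarrow> real" where
  "mpb_expected_revenue S M L \<Phi> tie A =
     (\<integral>\<omega>. measure_pmf.expectation
            (run A (mpb_policy S A (\<lambda>i. L i \<omega>) (\<lambda>i. \<Phi> i \<omega>) (tie \<omega>)) (customers A))
            (revenue S) \<partial>M)"

definition achieves_competitive_ratio :: "sales_setup \<Rightarrow> (arrivals \<Rightarrow> real) \<Rightarrow> real \<Rightarrow> bool" where
  "achieves_competitive_ratio S expected_revenue c \<longleftrightarrow>
     (\<forall>A. valid_arrivals S A \<longrightarrow> expected_revenue A \<ge> c * OPT S A)"

end

theory Submission
  imports Defs
begin

text \<open>
  Fix a realized initialization, a feasible LP solution \<open>x\<close>, and let \<open>W\<^sub>i(t)\<close> be the inventory of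
  item \<open>i\<close> that \<open>x\<close> uses up to customer \<open>t\<close>. The potential
  \<open>\<Sum>\<^sub>i (k\<^sub>i - W\<^sub>i(t)) \<Phi>\<^sub>i(N\<^sub>i / k\<^sub>i) + \<Sum>\<^sub>s\<^sub>\<le>\<^sub>t\<^sub>,\<^sub>i\<^sub>,\<^sub>j p x \<Phi>\<^sub>i(L\<^sub>i\<^sub>j)\<close>
  grows in time by the \<open>x\<close>-weighted average of the current bids, hence by at most the bid
  that the algorithm maximizes, and on a sale by at most \<open>k\<^sub>i\<close> times the increment of \<open>\<Phi>\<^sub>i\<close>. The
  increment condition says exactly that the revenue pays for \<open>c\<close> times both, so revenue minus
  \<open>c\<close> times the potential has nonnegative drift. At the end, \<open>W\<^sub>i \<le> k\<^sub>i\<close> makes the first sum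
  nonnegative, and integrating over the initialization turns \<open>\<Phi>\<^sub>i(L\<^sub>i\<^sub>j)\<close> into at least the price.
\<close>

subsection \<open>Runs of a policy\<close>

lemma finite_set_pmf_run: "finite (set_pmf (run A \<pi> t))"
  by (induction t) (auto split: option.splits)

text \<open>The horizon \<open>T\<close> gives the step cases \<open>t < T\<close>, so an invariant
  may rely on acceptance probabilities that are valid only for actual customers. Both outcomes
  \<open>a\<close> must preserve it, so no probabilities enter.\<close>

lemma run_invariant:
  assumes "h \<in> set_pmf (run A \<pi> t)" "t \<le> T"
    and "P 0 []"
    and "\<And>t h. t < T \<Longrightarrow> P t h \<Longrightarrow> \<pi> (Suc t) h = None \<Longrightarrow> P (Suc t) (None # h)"
    and "\<And>t h i j a. t < T \<Longrightarrow> P t h \<Longrightarrow> \<pi> (Suc t) h = Some (i, j) \<Longrightarrow> P (Suc t) (Some (i, j, a) # h)"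
  shows "P t h"
  using assms(1,2)
proof (induction t arbitrary: h)
  case 0
  then show ?case using assms(3) by simp
next
  case (Suc t)
  from Suc.prems(1) obtain h' where h': "h' \<in> set_pmf (run A \<pi> t)"
    and h: "h \<in> set_pmf (case \<pi> (Suc t) h' of
         None \<Rightarrow> return_pmf (None # h')
       | Some (i, j) \<Rightarrow>
           map_pmf (\<lambda>a. Some (i, j, a) # h') (bernoulli_pmf (accept_prob A (Suc t) i j)))"
    by auto
  have P: "P t h'" "t < T" using Suc.IH[OF h'] Suc.prems(2) by auto
  show ?case
  proof (cases "\<pi> (Suc t) h'")
    case None
    then show ?thesis using assms(4)[OF P(2,1)] h by simp
  next
    case (Some q)
    then show ?thesis using assms(5)[OF P(2,1)] h by (cases q) auto
  qed
qed

text \<open>Keeping \<open>pmf\<close> instead of \<open>p\<close> makes the formula valid for every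
  real \<open>p\<close>, also outside the unit interval.\<close>

lemma expectation_bernoulli_pmf_sum:
  "measure_pmf.expectation (bernoulli_pmf p) f = pmf (bernoulli_pmf p) True * f True + pmf (bernoulli_pmf p) False * (f False :: real)"
  by (subst integral_measure_pmf[of UNIV]) (auto simp: UNIV_bool)

text \<open>Conditioning on the history before the last customer. Both the measurability argument
  and the drift argument induct along this recursion.\<close>

lemma expectation_run_Suc:
  fixes g :: "history \<Rightarrow> real"
  shows "measure_pmf.expectation (run A \<pi> (Suc t)) g =
    measure_pmf.expectation (run A \<pi> t) (\<lambda>h. case \<pi> (Suc t) h of
       None \<Rightarrow> g (None # h)
     | Some (i, j) \<Rightarrow> measure_pmf.expectation (bernoulli_pmf (accept_prob A (Suc t) i j))
         (\<lambda>a. g (Some (i, j, a) # h)))"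
  unfolding run.simps
  by (subst pmf_expectation_bind[OF finite_set_pmf_run _ order.refl],
      force split: option.splits,
      subst integral_measure_pmf[OF finite_set_pmf_run[of A \<pi> t]])
    (auto split: option.splits intro!: sum.cong)

lemma expectation_mono_finite_support:
  fixes f g :: "'a \<Rightarrow> real"
  assumes "finite (set_pmf p)" "\<And>x. x \<in> set_pmf p \<Longrightarrow> f x \<le> g x"
  shows "measure_pmf.expectation p f \<le> measure_pmf.expectation p g"
  using assms by (auto intro!: integral_mono_AE integrable_measure_pmf_finite simp: AE_measure_pmf_iff)

text \<open>
  The restriction to histories in \<open>P\<close> is needed because nothing is known about the measurability
  of \<open>\<Phi>\<close> outside the grid, that is, on histories that exceed the inventory.
\<close>

lemma measurable_expectation_run:
  fixes g :: "'w \<Rightarrow> history \<Rightarrow> real"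
  assumes "t \<le> T"
    and "\<And>h. P h \<Longrightarrow> (\<lambda>\<omega>. g \<omega> h) \<in> borel_measurable M"
    and meas: "\<And>t h. t < T \<Longrightarrow> P h \<Longrightarrow> (\<lambda>\<omega>. \<pi> \<omega> (Suc t) h) \<in> measurable M (count_space UNIV)"
    and Nil: "P []"
    and None: "\<And>h. P h \<Longrightarrow> P (None # h)"
    and Some: "\<And>\<omega> t h i j a. \<omega> \<in> space M \<Longrightarrow> t < T \<Longrightarrow> P h \<Longrightarrow> \<pi> \<omega> (Suc t) h = Some (i, j) \<Longrightarrow> P (Some (i, j, a) # h)"
  shows "(\<lambda>\<omega>. measure_pmf.expectation (run A (\<pi> \<omega>) t) (g \<omega>)) \<in> borel_measurable M"
  using assms(1,2)
proof (induction t arbitrary: g)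
  case 0
  then show ?case using Nil by simp
next
  case (Suc t)
  \<comment> \<open>Conditional expectation of \<open>g\<close> given the history before customer
    \<open>Suc t\<close>; the induction hypothesis is applied to \<open>G\<close> in place of
    \<open>g\<close>.\<close>
  define G where "G \<omega> h = (case \<pi> \<omega> (Suc t) h of
       None \<Rightarrow> g \<omega> (None # h)
     | Some (i, j) \<Rightarrow> measure_pmf.expectation (bernoulli_pmf (accept_prob A (Suc t) i j))
         (\<lambda>a. g \<omega> (Some (i, j, a) # h)))" for \<omega> h
  have "(\<lambda>\<omega>. G \<omega> h) \<in> borel_measurable M" if h: "P h" for h
  proof -
    \<comment> \<open>Freeze the offer at \<open>q\<close>. Offers range over a countable type, so
      measurability of each \<open>F q\<close> suffices. The default \<open>0\<close> covers offers
      that would leave \<open>P\<close>, where \<open>g\<close> may fail to be measurable; the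
      policy never makes them.\<close>
    define F where "F q \<omega> = (case q of
       None \<Rightarrow> g \<omega> (None # h)
     | Some (i, j) \<Rightarrow> if P (Some (i, j, True) # h) \<and> P (Some (i, j, False) # h) then
         measure_pmf.expectation (bernoulli_pmf (accept_prob A (Suc t) i j))
         (\<lambda>a. g \<omega> (Some (i, j, a) # h)) else 0)" for q \<omega>
    have F: "F q \<in> borel_measurable M" for q
    proof (cases q)
      case None
      then show ?thesis using Suc.prems(2) assms(5)[OF h] by (simp add: F_def[abs_def])
    next
      case (Some r)
      obtain i j where r: "r = (i, j)" by (cases r)
      show ?thesis
        using Suc.prems(2)
        by (cases "P (Some (i, j, True) # h) \<and> P (Some (i, j, False) # h)")
          (auto simp: Some r F_def[abs_def] expectation_bernoulli_pmf_sum
            intro!: borel_measurable_add borel_measurable_times)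
    qed
    have "(\<lambda>\<omega>. F (\<pi> \<omega> (Suc t) h) \<omega>) \<in> borel_measurable M"
      using Suc.prems(1) by (intro measurable_compose_countable[OF F meas] h) simp
    also have "?this \<longleftrightarrow> ?thesis"
      using Some[of _ t h] h Suc.prems(1)
      by (intro measurable_cong) (auto simp: G_def F_def split: option.splits)
    finally show ?thesis .
  qed
  then show ?case
    using Suc.IH[of G] Suc.prems(1) by (simp add: expectation_run_Suc G_def del: run.simps)
qed

subsection \<open>Realized initializations\<close>

text \<open>On such histories \<open>sold h i / inventory S i\<close> is a grid point, and only at
  grid points is \<open>\<Phi>\<close> controlled.\<close>

definition within_inventory :: "sales_setup \<Rightarrow> history \<Rightarrow> bool" where
  "within_inventory S h \<longleftrightarrow> (\<forall>i\<in>{1..items S}. sold h i \<le> inventory S i)"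

text \<open>Facts that the initialization guarantees at a single outcome; with them the argument up
  to the final averaging treats \<open>L\<close> and \<open>\<Phi>\<close> as fixed.\<close>

definition valid_realization :: "sales_setup \<Rightarrow> (nat \<Rightarrow> nat \<Rightarrow> real) \<Rightarrow> (nat \<Rightarrow> real \<Rightarrow> real) \<Rightarrow> bool" where
  "valid_realization S L \<Phi> \<longleftrightarrow> (\<forall>i\<in>{1..items S}.
     (\<forall>j\<in>{1..num_prices S i}. L i j \<in> grid (inventory S i)) \<and>
     mono_on (grid (inventory S i)) (\<Phi> i) \<and> \<Phi> i 0 = 0)"

lemma sold_Nil [simp]: "sold [] i = 0"
  and sold_None [simp]: "sold (None # h) i = sold h i"
  and sold_Some [simp]: "sold (Some (i', j, a) # h) i = (if a \<and> i' = i then Suc (sold h i) else sold h i)"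
  by (auto simp: sold_def)

lemma revenue_Nil [simp]: "revenue S [] = 0"
  and revenue_None [simp]: "revenue S (None # h) = revenue S h"
  and revenue_Some [simp]: "revenue S (Some (i, j, a) # h) = (if a then price S i j else 0) + revenue S h"
  by (auto simp: revenue_def)

lemma finite_offers [simp]: "finite (offers S)"
  by (simp add: offers_def)

lemma grid_memI: "N \<le> k \<Longrightarrow> real N / real k \<in> grid k"
  by (auto simp: grid_def)

lemma grid_memE:
  assumes "y \<in> grid k"
  obtains N where "y = real N / real k" "N \<le> k"
  using assms unfolding grid_def by (elim imageE) (rule that, auto)

lemma value_nonneg:
  assumes "valid_realization S L \<Phi>" "i \<in> {1..items S}" "y \<in> grid (inventory S i)"
  shows "0 \<le> \<Phi> i y"
proof -
  have "mono_on (grid (inventory S i)) (\<Phi> i)" "\<Phi> i 0 = 0"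
    using assms by (auto simp: valid_realization_def)
  moreover have "0 \<in> grid (inventory S i)" "0 \<le> y"
    using grid_memI[of 0 "inventory S i"] assms(3) by (auto simp: grid_def)
  ultimately show ?thesis
    using assms(3) by (metis mono_onD)
qed

text \<open>As \<open>accept_prob\<close> is nonnegative, a positive bid forces the value at
  \<open>sold h i\<close> to lie below the value at the border, and monotonicity puts the sold
  fraction below the border. Both are grid points, so their numerators differ by at least one:
  \<open>N = sold h i\<close> is in the range of the increment condition, and a unit is
  left.\<close>

lemma positive_bid:
  assumes "valid_realization S L \<Phi>" "valid_setup S" "valid_arrivals S A" "t \<in> {1..customers A}"
    and "within_inventory S h" "(i, j) \<in> offers S" "0 < bid S A L \<Phi> t h (i, j)"
  shows "real (sold h i) \<le> L i j * real (inventory S i) - 1" "sold h i < inventory S i"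
proof -
  let ?k = "inventory S i"
  have i: "i \<in> {1..items S}" "j \<in> {1..num_prices S i}"
    using assms(6) by (auto simp: offers_def)
  have k: "0 < ?k" using assms(2) i by (force simp: valid_setup_def)
  have L: "L i j \<in> grid ?k" and mono: "mono_on (grid ?k) (\<Phi> i)"
    using assms(1) i by (auto simp: valid_realization_def)
  then obtain m where m: "L i j = real m / real ?k" "m \<le> ?k" by (elim grid_memE)
  have s: "real (sold h i) / real ?k \<in> grid ?k"
    using assms(5) i by (intro grid_memI) (auto simp: within_inventory_def)
  have "0 \<le> accept_prob A t i j"
    using assms(3,4,6) by (force simp: valid_arrivals_def)
  then have "\<Phi> i (real (sold h i) / real ?k) < \<Phi> i (L i j)"
    using assms(7) by (auto simp: bid_def zero_less_mult_iff)
  then have "real (sold h i) / real ?k < L i j"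
    using mono_onD[OF mono L s] by linarith
  then have "sold h i < m" using k by (simp add: m(1) divide_less_cancel)
  then show "real (sold h i) \<le> L i j * real ?k - 1" "sold h i < ?k"
    using k m by auto
qed

section \<open>Offers chosen by the policy\<close>

definition choice_function :: "(history \<Rightarrow> 'a set \<Rightarrow> 'a) \<Rightarrow> bool" where
  "choice_function f \<longleftrightarrow> (\<forall>h C. C \<noteq> {} \<longrightarrow> f h C \<in> C)"

lemma mpb_policy_Some:
  assumes "choice_function tie" "mpb_policy S A L \<Phi> tie t h = Some q"
  shows "q \<in> offers S" "0 < bid S A L \<Phi> t h q" "\<forall>q'\<in>offers S. bid S A L \<Phi> t h q' \<le> bid S A L \<Phi> t h q"
proof -
  let ?C = "{q \<in> offers S. 0 < bid S A L \<Phi> t h q \<and>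
                 (\<forall>q'\<in>offers S. bid S A L \<Phi> t h q' \<le> bid S A L \<Phi> t h q)}"
  have ne: "?C \<noteq> {}" and q: "q = tie h ?C"
    using assms(2) unfolding mpb_policy_def Let_def by (auto split: if_splits)
  have "q \<in> ?C" using assms(1)[unfolded choice_function_def, rule_format, OF ne, of h] by (subst q)
  then show "q \<in> offers S" "0 < bid S A L \<Phi> t h q" "\<forall>q'\<in>offers S. bid S A L \<Phi> t h q' \<le> bid S A L \<Phi> t h q"
    by auto
qed

text \<open>The finite set of offers attains its maximal bid. If some bid were positive, the
  maximizer would be a candidate and something would be offered.\<close>

lemma mpb_policy_None:
  assumes "mpb_policy S A L \<Phi> tie t h = None" "q \<in> offers S"
  shows "bid S A L \<Phi> t h q \<le> 0"
proof (rule ccontr)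
  let ?f = "bid S A L \<Phi> t h"
  assume pos: "\<not> ?f q \<le> 0"
  have "Max (?f ` offers S) \<in> ?f ` offers S"
    using assms(2) by (intro Max_in) auto
  then obtain m where m: "m \<in> offers S" "Max (?f ` offers S) = ?f m" by blast
  have max: "?f q' \<le> ?f m" if "q' \<in> offers S" for q'
    using that by (simp flip: m(2))
  have "{q \<in> offers S. 0 < ?f q \<and> (\<forall>q'\<in>offers S. ?f q' \<le> ?f q)} = {}"
    using assms(1) unfolding mpb_policy_def Let_def by (simp split: if_splits)
  moreover have "0 < ?f m" using pos max[OF assms(2)] by linarith
  ultimately show False using m(1) max by blast
qed

lemma within_inventory_Some:
  assumes "valid_realization S L \<Phi>" "valid_setup S" "valid_arrivals S A" "t \<in> {1..customers A}"
    and "within_inventory S h" "choice_function tie"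
    and "mpb_policy S A L \<Phi> tie t h = Some (i, j)"
  shows "within_inventory S (Some (i, j, a) # h)"
  using positive_bid(2)[OF assms(1-5) mpb_policy_Some(1,2)[OF assms(6,7)]] assms(5)
  by (auto simp: within_inventory_def)

subsection \<open>The potential\<close>

definition lp_usage :: "sales_setup \<Rightarrow> arrivals \<Rightarrow> (nat \<Rightarrow> nat \<Rightarrow> nat \<Rightarrow> real) \<Rightarrow> nat \<Rightarrow> nat \<Rightarrow> real" where
  "lp_usage S A x t i = (\<Sum>s=1..t. \<Sum>j=1..num_prices S i. accept_prob A s i j * x s i j)"

text \<open>The LP objective up to customer \<open>t\<close> with each price replaced by the
  realized value at its border, whose mean is at least that price.\<close>

definition lp_value ::
  "sales_setup \<Rightarrow> arrivals \<Rightarrow> (nat \<Rightarrow> nat \<Rightarrow> real) \<Rightarrow> (nat \<Rightarrow> real \<Rightarrow> real) \<Rightarrow>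
   (nat \<Rightarrow> nat \<Rightarrow> nat \<Rightarrow> real) \<Rightarrow> nat \<Rightarrow> real" where
  "lp_value S A L \<Phi> x t =
     (\<Sum>s=1..t. \<Sum>i=1..items S. \<Sum>j=1..num_prices S i. accept_prob A s i j * \<Phi> i (L i j) * x s i j)"

definition potential ::
  "sales_setup \<Rightarrow> arrivals \<Rightarrow> (nat \<Rightarrow> nat \<Rightarrow> real) \<Rightarrow> (nat \<Rightarrow> real \<Rightarrow> real) \<Rightarrow>
   (nat \<Rightarrow> nat \<Rightarrow> nat \<Rightarrow> real) \<Rightarrow> nat \<Rightarrow> history \<Rightarrow> real" where
  "potential S A L \<Phi> x t h =
     (\<Sum>i=1..items S. (real (inventory S i) - lp_usage S A x t i) *
        \<Phi> i (real (sold h i) / real (inventory S i))) + lp_value S A L \<Phi> x t"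

lemma lp_usage_nonneg:
  assumes "lp_feasible S A x" "valid_arrivals S A" "t \<le> customers A" "i \<in> {1..items S}"
  shows "0 \<le> lp_usage S A x t i"
  unfolding lp_usage_def
  using assms by (force simp: lp_feasible_def valid_arrivals_def offers_def intro!: sum_nonneg mult_nonneg_nonneg)

lemma potential_None [simp]: "potential S A L \<Phi> x t (None # h) = potential S A L \<Phi> x t h"
  and potential_rejected [simp]:
    "potential S A L \<Phi> x t (Some (i, j, False) # h) = potential S A L \<Phi> x t h"
  by (simp_all add: potential_def)

lemma potential_accepted:
  assumes "i \<in> {1..items S}"
  shows "potential S A L \<Phi> x t (Some (i, j, True) # h) =
    potential S A L \<Phi> x t h + (real (inventory S i) - lp_usage S A x t i) *
      (\<Phi> i (real (sold h i + 1) / real (inventory S i)) - \<Phi> i (real (sold h i) / real (inventory S i)))"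
proof -
  have "(\<Sum>i'=1..items S. (real (inventory S i') - lp_usage S A x t i') *
        \<Phi> i' (real (sold (Some (i, j, True) # h) i') / real (inventory S i'))) =
     (\<Sum>i'=1..items S. (real (inventory S i') - lp_usage S A x t i') *
        \<Phi> i' (real (sold h i') / real (inventory S i')) +
      (if i' = i then (real (inventory S i) - lp_usage S A x t i) *
      (\<Phi> i (real (sold h i + 1) / real (inventory S i)) - \<Phi> i (real (sold h i) / real (inventory S i))) else 0))"
    by (intro sum.cong) (auto simp: algebra_simps)
  also have "\<dots> = (\<Sum>i'=1..items S. (real (inventory S i') - lp_usage S A x t i') *
        \<Phi> i' (real (sold h i') / real (inventory S i'))) + (real (inventory S i) - lp_usage S A x t i) *
      (\<Phi> i (real (sold h i + 1) / real (inventory S i)) - \<Phi> i (real (sold h i) / real (inventory S i)))"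
    using assms by (simp add: sum.distrib)
  finally show ?thesis by (simp add: potential_def)
qed

text \<open>At a fixed history, each \<open>p * x\<close> added to the usage removes
  \<open>p * x\<close> times the value at the current stock and adds \<open>p * x\<close> times the
  value at the border. The difference is \<open>x\<close> times the bid.\<close>

lemma potential_Suc:
  "potential S A L \<Phi> x (Suc t) h = potential S A L \<Phi> x t h +
     (\<Sum>i=1..items S. \<Sum>j=1..num_prices S i. x (Suc t) i j * bid S A L \<Phi> (Suc t) h (i, j))"
proof -
  let ?u = "\<lambda>i. \<Phi> i (real (sold h i) / real (inventory S i))"
  have W: "lp_usage S A x (Suc t) i = lp_usage S A x t i +
      (\<Sum>j=1..num_prices S i. accept_prob A (Suc t) i j * x (Suc t) i j)" for i
    by (simp add: lp_usage_def)
  have V: "lp_value S A L \<Phi> x (Suc t) = lp_value S A L \<Phi> x t +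
     (\<Sum>i=1..items S. \<Sum>j=1..num_prices S i. accept_prob A (Suc t) i j * \<Phi> i (L i j) * x (Suc t) i j)"
    by (simp add: lp_value_def)
  have "(\<Sum>i=1..items S. \<Sum>j=1..num_prices S i. x (Suc t) i j * bid S A L \<Phi> (Suc t) h (i, j)) =
    (\<Sum>i=1..items S. \<Sum>j=1..num_prices S i. accept_prob A (Suc t) i j * \<Phi> i (L i j) * x (Suc t) i j) -
    (\<Sum>i=1..items S. (\<Sum>j=1..num_prices S i. accept_prob A (Suc t) i j * x (Suc t) i j) * ?u i)"
    by (simp add: bid_def algebra_simps sum_subtractf sum_distrib_left)
  then show ?thesis
    by (simp add: potential_def W V algebra_simps sum_subtractf sum.distrib)
qed

text \<open>The weights of one customer are nonnegative with sum at most 1. The sum may be smaller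
  than 1, hence the requirement \<open>0 \<le> B\<close>. The uses are \<open>B = 0\<close> when
  nothing is offered and \<open>B\<close> the winning bid otherwise.\<close>

lemma lp_weighted_bids_le:
  assumes "lp_feasible S A x" "t \<in> {1..customers A}" "0 \<le> B" "\<forall>q\<in>offers S. f q \<le> B"
  shows "(\<Sum>i=1..items S. \<Sum>j=1..num_prices S i. x t i j * f (i, j)) \<le> B"
proof -
  have "(\<Sum>i=1..items S. \<Sum>j=1..num_prices S i. x t i j * f (i, j)) \<le>
      (\<Sum>i=1..items S. \<Sum>j=1..num_prices S i. x t i j * B)"
    using assms by (intro sum_mono mult_left_mono) (auto simp: lp_feasible_def offers_def)
  also have "\<dots> = (\<Sum>i=1..items S. \<Sum>j=1..num_prices S i. x t i j) * B"
    by (simp add: sum_distrib_right)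
  also have "\<dots> \<le> 1 * B"
    using assms by (intro mult_right_mono) (auto simp: lp_feasible_def)
  finally show ?thesis by simp
qed

section \<open>Drift caused by one customer\<close>

text \<open>The range of \<open>N\<close> is stated over the reals, so it is empty when
  \<open>L i j = 0\<close>; subtraction on naturals would truncate to \<open>0\<close>
  there.\<close>

definition increment_condition :: "sales_setup \<Rightarrow> (nat \<Rightarrow> nat \<Rightarrow> real) \<Rightarrow> (nat \<Rightarrow> real \<Rightarrow> real) \<Rightarrow> real \<Rightarrow> bool" where
  "increment_condition S L \<Phi> c \<longleftrightarrow> (\<forall>i\<in>{1..items S}. \<forall>j\<in>{1..num_prices S i}. \<forall>N::nat.
             real N \<le> L i j * real (inventory S i) - 1 \<longrightarrow>
             real (inventory S i) *
                 (\<Phi> i (real (N + 1) / real (inventory S i)) -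
                  \<Phi> i (real N / real (inventory S i)))
               + \<Phi> i (L i j) - \<Phi> i (real N / real (inventory S i))
             \<le> price S i j / c)"

text \<open>The increment condition at \<open>N = sold h i\<close> has the coefficient
  \<open>inventory S i\<close>. Subtracting the nonnegative usage from it only decreases the left
  side, because the increment of \<open>\<Phi>\<close> is nonnegative.\<close>

lemma accepted_sale_bound:
  assumes "valid_realization S L \<Phi>" "valid_setup S" "valid_arrivals S A" "lp_feasible S A x"
    and "increment_condition S L \<Phi> c" "0 < c" "t < customers A"
    and "within_inventory S h" "(i, j) \<in> offers S" "0 < bid S A L \<Phi> (Suc t) h (i, j)"
  shows "c * ((real (inventory S i) - lp_usage S A x (Suc t) i) *
      (\<Phi> i (real (sold h i + 1) / real (inventory S i)) - \<Phi> i (real (sold h i) / real (inventory S i)))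
      + (\<Phi> i (L i j) - \<Phi> i (real (sold h i) / real (inventory S i)))) \<le> price S i j"
proof -
  let ?k = "inventory S i" and ?W = "lp_usage S A x (Suc t) i"
  let ?d = "\<Phi> i (real (sold h i + 1) / real ?k) - \<Phi> i (real (sold h i) / real ?k)"
  let ?b = "\<Phi> i (L i j) - \<Phi> i (real (sold h i) / real ?k)"
  have i: "i \<in> {1..items S}" "j \<in> {1..num_prices S i}"
    using assms(9) by (auto simp: offers_def)
  have "Suc t \<in> {1..customers A}" using assms(7) by simp
  note pos = positive_bid[OF assms(1,2,3) this assms(8-10)]
  have "mono_on (grid ?k) (\<Phi> i)" using assms(1) i by (auto simp: valid_realization_def)
  \<comment> \<open>Monotonicity holds only on the grid; the unsold unit keeps
    \<open>sold h i + 1\<close> within it.\<close>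
  then have d: "0 \<le> ?d"
    using mono_onD[of "grid ?k" "\<Phi> i" "real (sold h i) / real ?k" "real (sold h i + 1) / real ?k"] pos(2)
      grid_memI[of "sold h i" ?k] grid_memI[of "sold h i + 1" ?k]
    by (simp add: divide_right_mono)
  have "(real ?k - ?W) * ?d + ?b \<le> real ?k * ?d + ?b"
    using lp_usage_nonneg[OF assms(4,3) _ i(1), of "Suc t"] assms(7) d
    by (auto intro!: mult_right_mono)
  also have "\<dots> \<le> price S i j / c"
    using assms(5) i pos(1) unfolding increment_condition_def by (fastforce simp: algebra_simps)
  finally show ?thesis
    using assms(6) by (simp add: pos_le_divide_eq mult.commute)
qed

text \<open>The submartingale property of revenue minus \<open>c\<close> times the potential. Growth
  in time costs at most \<open>c\<close> times the winning bid, a sale costs \<open>c\<close> times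
  the increment term, and the expected price covers both.\<close>

lemma expectation_step:
  assumes "valid_realization S L \<Phi>" "valid_setup S" "valid_arrivals S A" "lp_feasible S A x"
    and "increment_condition S L \<Phi> c" "0 < c" "t < customers A"
    and "within_inventory S h" "choice_function tie"
  defines "g \<equiv> \<lambda>t h. revenue S h - c * potential S A L \<Phi> x t h"
  shows "g t h \<le> (case mpb_policy S A L \<Phi> tie (Suc t) h of
       None \<Rightarrow> g (Suc t) (None # h)
     | Some (i, j) \<Rightarrow> measure_pmf.expectation (bernoulli_pmf (accept_prob A (Suc t) i j))
         (\<lambda>a. g (Suc t) (Some (i, j, a) # h)))"
proof -
  let ?D = "(\<Sum>i=1..items S. \<Sum>j=1..num_prices S i. x (Suc t) i j * bid S A L \<Phi> (Suc t) h (i, j))"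
  have t: "Suc t \<in> {1..customers A}" using assms(7) by simp
  show ?thesis
  proof (cases "mpb_policy S A L \<Phi> tie (Suc t) h")
    case None
    then have "?D \<le> 0"
      by (intro lp_weighted_bids_le[OF assms(4) t]) (auto intro: mpb_policy_None)
    then show ?thesis
      using None \<open>0 < c\<close> by (simp add: g_def potential_Suc[where h = h] algebra_simps mult_le_0_iff)
  next
    case (Some q)
    obtain i j where q: "q = (i, j)" by (cases q)
    note pol = mpb_policy_Some[OF assms(9) Some[unfolded q]]
    let ?B = "bid S A L \<Phi> (Suc t) h (i, j)" and ?p = "accept_prob A (Suc t) i j"
    have i: "i \<in> {1..items S}" using pol(1) by (auto simp: offers_def)
    have p: "0 \<le> ?p" "?p \<le> 1" using assms(3) pol(1) t by (force simp: valid_arrivals_def)+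
    let ?X = "(real (inventory S i) - lp_usage S A x (Suc t) i) *
      (\<Phi> i (real (sold h i + 1) / real (inventory S i)) - \<Phi> i (real (sold h i) / real (inventory S i)))"
    let ?b = "\<Phi> i (L i j) - \<Phi> i (real (sold h i) / real (inventory S i))"
    have "c * ?D \<le> c * ?B"
      using \<open>0 < c\<close> pol by (intro mult_left_mono lp_weighted_bids_le[OF assms(4) t]) auto
    \<comment> \<open>The bid is \<open>?p * ?b\<close>; adding and subtracting the sale term
      \<open>?X\<close> produces the expression bounded by the price.\<close>
    also have "\<dots> = ?p * (c * (?X + ?b)) - ?p * (c * ?X)"
      by (simp add: bid_def algebra_simps)
    also have "?p * (c * (?X + ?b)) \<le> ?p * price S i j"
      using p accepted_sale_bound[OF assms(1-8) pol(1,2)] by (intro mult_left_mono) auto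
    finally have *: "c * ?D \<le> ?p * price S i j - ?p * (c * ?X)" by simp
    \<comment> \<open>Time growth is paid whatever the customer does, the sale terms only with
      probability \<open>?p\<close>.\<close>
    have "measure_pmf.expectation (bernoulli_pmf ?p) (\<lambda>a. g (Suc t) (Some (i, j, a) # h)) =
       g t h - c * ?D + ?p * (price S i j - c * ?X)"
      using p by (simp add: g_def potential_accepted[OF i] potential_Suc[where h = h] algebra_simps)
    then show ?thesis using Some q * by (simp add: right_diff_distrib)
  qed
qed

section \<open>Revenue for a fixed initialization\<close>

lemma support_within_inventory:
  assumes "valid_realization S L \<Phi>" "valid_setup S" "valid_arrivals S A" "t \<le> customers A"
    and "choice_function tie"
    and "h \<in> set_pmf (run A (mpb_policy S A L \<Phi> tie) t)"
  shows "within_inventory S h"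
  using assms(6,4)
proof (rule run_invariant)
  fix t h i j a
  assume "t < customers A" "within_inventory S h" "mpb_policy S A L \<Phi> tie (Suc t) h = Some (i, j)"
  then show "within_inventory S (Some (i, j, a) # h)"
    by (intro within_inventory_Some[OF assms(1-3) _ _ assms(5)]) auto
qed (auto simp: within_inventory_def)

text \<open>The expectation is over acceptances only. The drift inequality is chained from the empty
  history, where the potential vanishes since \<open>\<Phi> i 0 = 0\<close>, to the last
  customer.\<close>

lemma lp_value_le_expected_revenue:
  assumes "valid_realization S L \<Phi>" "valid_setup S" "valid_arrivals S A" "lp_feasible S A x"
    and "increment_condition S L \<Phi> c" "0 < c" "choice_function tie"
  shows "c * lp_value S A L \<Phi> x (customers A) \<le>
    measure_pmf.expectation (run A (mpb_policy S A L \<Phi> tie) (customers A)) (revenue S)"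
proof -
  let ?R = "run A (mpb_policy S A L \<Phi> tie)" and ?T = "customers A"
  define g where "g t h = revenue S h - c * potential S A L \<Phi> x t h" for t h
  have "0 \<le> measure_pmf.expectation (?R t) (g t)" if "t \<le> ?T" for t
    using that
  proof (induction t)
    case 0
    have "\<forall>i\<in>{1..items S}. \<Phi> i 0 = 0" using assms(1) by (auto simp: valid_realization_def)
    then show ?case by (simp add: g_def potential_def lp_value_def)
  next
    case (Suc t)
    then have "0 \<le> measure_pmf.expectation (?R t) (g t)" by simp
    also have "\<dots> \<le> measure_pmf.expectation (?R (Suc t)) (g (Suc t))"
      unfolding expectation_run_Suc g_def
      using Suc.prems
      by (intro expectation_mono_finite_support[OF finite_set_pmf_run] expectation_step[OF assms(1-6)]
          support_within_inventory[OF assms(1-3) _ assms(7)] assms(7)) auto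
    finally show ?case .
  qed
  then have "0 \<le> measure_pmf.expectation (?R ?T) (g ?T)" by simp
  also have "\<dots> \<le> measure_pmf.expectation (?R ?T) (\<lambda>h. revenue S h - c * lp_value S A L \<Phi> x ?T)"
  proof (rule expectation_mono_finite_support[OF finite_set_pmf_run])
    fix h assume h: "h \<in> set_pmf (?R ?T)"
    have "within_inventory S h"
      by (rule support_within_inventory[OF assms(1-3) order.refl assms(7) h])
    then have "0 \<le> (\<Sum>i=1..items S. (real (inventory S i) - lp_usage S A x ?T i) *
        \<Phi> i (real (sold h i) / real (inventory S i)))"
      using assms(4)
      by (intro sum_nonneg mult_nonneg_nonneg value_nonneg[OF assms(1)] grid_memI)
        (auto simp: within_inventory_def lp_feasible_def lp_usage_def)
    then show "g ?T h \<le> revenue S h - c * lp_value S A L \<Phi> x ?T"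
      using \<open>0 < c\<close> by (auto simp: g_def potential_def)
  qed
  also have "\<dots> = measure_pmf.expectation (?R ?T) (revenue S) - c * lp_value S A L \<Phi> x ?T"
    by (subst Bochner_Integration.integral_diff)
      (auto intro: integrable_measure_pmf_finite finite_set_pmf_run)
  finally show ?thesis by simp
qed

text \<open>Each customer pays at most the sum of all prices. The bound does not depend on the
  realization, which yields integrability over the initialization.\<close>

lemma expected_revenue_bounded:
  assumes "valid_setup S" "choice_function tie"
  shows "\<bar>measure_pmf.expectation (run A (mpb_policy S A L \<Phi> tie) t) (revenue S)\<bar>
    \<le> real t * (\<Sum>(i, j)\<in>offers S. price S i j)"
proof -
  let ?p = "run A (mpb_policy S A L \<Phi> tie) t" and ?R = "\<Sum>(i, j)\<in>offers S. price S i j"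
  have nonneg: "0 \<le> price S i j" if "(i, j) \<in> offers S" for i j
  proof -
    have "i \<in> {1..items S}" "j \<in> {1..num_prices S i}" using that by (auto simp: offers_def)
    then have "0 < price S i j" using assms(1) unfolding valid_setup_def by blast
    then show ?thesis by simp
  qed
  then have R: "0 \<le> ?R" by (auto intro!: sum_nonneg)
  have le: "price S i j \<le> ?R" if "(i, j) \<in> offers S" for i j
    using member_le_sum[OF that, of "\<lambda>(i, j). price S i j"] nonneg by auto
  have bound: "0 \<le> revenue S h \<and> revenue S h \<le> real t * ?R" if "h \<in> set_pmf ?p" for h
    using that order.refl
  proof (rule run_invariant)
    fix s h i j a
    assume h: "0 \<le> revenue S h \<and> revenue S h \<le> real s * ?R"
      and "mpb_policy S A L \<Phi> tie (Suc s) h = Some (i, j)"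
    then have "(i, j) \<in> offers S" using mpb_policy_Some(1)[OF assms(2)] by blast
    from le[OF this] nonneg[OF this] h R
    show "0 \<le> revenue S (Some (i, j, a) # h) \<and> revenue S (Some (i, j, a) # h) \<le> real (Suc s) * ?R"
      by (auto simp: algebra_simps)
  qed (use R in \<open>auto simp: algebra_simps\<close>)
  have "measure_pmf.expectation ?p (revenue S) \<le> measure_pmf.expectation ?p (\<lambda>_. real t * ?R)"
    using bound by (intro expectation_mono_finite_support finite_set_pmf_run) auto
  moreover have "measure_pmf.expectation ?p (\<lambda>_. 0) \<le> measure_pmf.expectation ?p (revenue S)"
    using bound by (intro expectation_mono_finite_support finite_set_pmf_run) auto
  ultimately show ?thesis by simp
qed

subsection \<open>Measurability\<close>

lemma mpb_initialization_valid_realization: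
  assumes "mpb_initialization S M L \<Phi>" "\<omega> \<in> space M"
  shows "valid_realization S (\<lambda>i. L i \<omega>) (\<lambda>i. \<Phi> i \<omega>)"
  using assms by (fastforce simp: mpb_initialization_def valid_realization_def)

lemma mpb_initialization_measurable:
  assumes "mpb_initialization S M L \<Phi>" "i \<in> {1..items S}"
  shows "j \<in> {0..num_prices S i} \<Longrightarrow> (\<lambda>\<omega>. L i \<omega> j) \<in> borel_measurable M"
    and "y \<in> grid (inventory S i) \<Longrightarrow> (\<lambda>\<omega>. \<Phi> i \<omega> y) \<in> borel_measurable M"
proof -
  interpret prob_space M using assms by (simp add: mpb_initialization_def)
  have pair: "(\<lambda>\<omega>. (restrict (L i \<omega>) {0..num_prices S i}, restrict (\<Phi> i \<omega>) (grid (inventory S i))))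
     \<in> measurable M ((\<Pi>\<^sub>M j\<in>{0..num_prices S i}. borel) \<Otimes>\<^sub>M (\<Pi>\<^sub>M x\<in>grid (inventory S i). borel))"
    using assms by (simp add: mpb_initialization_def indep_vars_def)
  { assume j: "j \<in> {0..num_prices S i}"
    have "(\<lambda>\<omega>. restrict (L i \<omega>) {0..num_prices S i} j) \<in> borel_measurable M"
      using measurable_compose[OF measurable_compose[OF pair measurable_fst]
          measurable_component_singleton[OF j]] by (simp add: comp_def)
    then show "(\<lambda>\<omega>. L i \<omega> j) \<in> borel_measurable M" using j by simp }
  { assume y: "y \<in> grid (inventory S i)"
    have "(\<lambda>\<omega>. restrict (\<Phi> i \<omega>) (grid (inventory S i)) y) \<in> borel_measurable M"
      using measurable_compose[OF measurable_compose[OF pair measurable_snd]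
          measurable_component_singleton[OF y]] by (simp add: comp_def)
    then show "(\<lambda>\<omega>. \<Phi> i \<omega> y) \<in> borel_measurable M" using y by simp }
qed

text \<open>A random function is evaluated at a random point. The point lies in a finite grid, so
  the value is a finite sum over the possible points.\<close>

lemma border_value_measurable:
  assumes "mpb_initialization S M L \<Phi>" "(i, j) \<in> offers S"
  shows "(\<lambda>\<omega>. \<Phi> i \<omega> (L i \<omega> j)) \<in> borel_measurable M"
proof -
  let ?G = "grid (inventory S i)"
  have i: "i \<in> {1..items S}" and j: "j \<in> {0..num_prices S i}" "j \<in> {1..num_prices S i}"
    using assms(2) by (auto simp: offers_def)
  note [measurable] = mpb_initialization_measurable(1)[OF assms(1) i j(1)]
    mpb_initialization_measurable(2)[OF assms(1) i]
  have fin: "finite ?G" by (simp add: grid_def)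
  have "(\<lambda>\<omega>. \<Sum>y\<in>?G. if L i \<omega> j = y then \<Phi> i \<omega> y else 0) \<in> borel_measurable M"
    by measurable
  also have "?this \<longleftrightarrow> ?thesis"
    using mpb_initialization_valid_realization[OF assms(1)] i j(2) fin
    by (intro measurable_cong) (auto simp: valid_realization_def)
  finally show ?thesis .
qed

text \<open>The set of maximizing offers takes finitely many values, and for each fixed value the
  tie-breaking choice is measurable.\<close>

lemma mpb_policy_measurable:
  assumes "mpb_initialization S M L \<Phi>" "tie_breaking M tie" "within_inventory S h"
  shows "(\<lambda>\<omega>. mpb_policy S A (\<lambda>i. L i \<omega>) (\<lambda>i. \<Phi> i \<omega>) (tie \<omega>) t h) \<in> measurable M (count_space UNIV)"
proof -
  let ?bid = "\<lambda>\<omega>. bid S A (\<lambda>i. L i \<omega>) (\<lambda>i. \<Phi> i \<omega>) t h"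
  define B where "B \<omega> q \<longleftrightarrow> 0 < ?bid \<omega> q \<and> (\<forall>q'\<in>offers S. ?bid \<omega> q' \<le> ?bid \<omega> q)" for \<omega> q
  define C where "C \<omega> = {q \<in> offers S. B \<omega> q}" for \<omega>
  have [measurable]: "(\<lambda>\<omega>. ?bid \<omega> q) \<in> borel_measurable M" if "q \<in> offers S" for q
  proof -
    obtain i j where q: "q = (i, j)" by (cases q)
    have "real (sold h i) / real (inventory S i) \<in> grid (inventory S i)" and "i \<in> {1..items S}"
      using assms(3) that q by (auto simp: within_inventory_def offers_def intro!: grid_memI)
    note [measurable] = mpb_initialization_measurable(2)[OF assms(1) this(2,1)]
      border_value_measurable[OF assms(1) that[unfolded q]]
    show ?thesis unfolding bid_def q by simp
  qed
  have "countable (Pow (offers S))" by (simp add: countable_finite)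
  moreover have "C \<in> measurable M (count_space (Pow (offers S)))"
  proof (rule measurable_count_space_eq2[THEN iffD2], simp, intro conjI ballI)
    show "C \<in> space M \<rightarrow> Pow (offers S)" by (auto simp: C_def)
    fix D assume "D \<in> Pow (offers S)"
    \<comment> \<open>The event that the candidate set equals \<open>D\<close> is a finite
      combination of comparisons between measurable bids.\<close>
    then have "C \<omega> = D \<longleftrightarrow> (\<forall>q\<in>offers S. q \<in> D \<longleftrightarrow> B \<omega> q)" for \<omega>
      unfolding C_def by blast
    then have "C -` {D} \<inter> space M = {\<omega> \<in> space M. \<forall>q\<in>offers S. q \<in> D \<longleftrightarrow> B \<omega> q}"
      by auto
    also have "\<dots> \<in> sets M"
      unfolding B_def by measurable
    finally show "C -` {D} \<inter> space M \<in> sets M" .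
  qed
  moreover have "(\<lambda>\<omega>. if D = {} then None else Some (tie \<omega> h D)) \<in> measurable M (count_space UNIV)" for D
  proof -
    have [measurable]: "(\<lambda>\<omega>. tie \<omega> h D) \<in> measurable M (count_space UNIV)"
      using assms(2) by (simp add: tie_breaking_def)
    show ?thesis by measurable
  qed
  ultimately have "(\<lambda>\<omega>. if C \<omega> = {} then None else Some (tie \<omega> h (C \<omega>))) \<in> measurable M (count_space UNIV)"
    by (intro measurable_compose_countable'[where I = "Pow (offers S)" and g = C
          and f = "\<lambda>D \<omega>. if D = {} then None else Some (tie \<omega> h D)"]) auto
  then show ?thesis by (simp only: mpb_policy_def C_def B_def Let_def)
qed

section \<open>Averaging over the initialization\<close>

theorem theorem4:
  fixes S :: sales_setup
    and M :: "'w measure"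
    and L :: "nat \<Rightarrow> 'w \<Rightarrow> nat \<Rightarrow> real"
    and \<Phi> :: "nat \<Rightarrow> 'w \<Rightarrow> real \<Rightarrow> real"
    and tie :: "'w \<Rightarrow> history \<Rightarrow> (nat \<times> nat) set \<Rightarrow> nat \<times> nat"
    and c :: real
  assumes "0 < c"
    and "valid_setup S"
    and "mpb_initialization S M L \<Phi>"
    and "tie_breaking M tie"
    and "\<And>i. i \<in> {1..items S} \<Longrightarrow>
           AE \<omega> in M. \<forall>j\<in>{1..num_prices S i}. \<forall>N::nat.
             real N \<le> L i \<omega> j * real (inventory S i) - 1 \<longrightarrow>
             real (inventory S i) *
                 (\<Phi> i \<omega> (real (N + 1) / real (inventory S i)) -
                  \<Phi> i \<omega> (real N / real (inventory S i)))
               + \<Phi> i \<omega> (L i \<omega> j) - \<Phi> i \<omega> (real N / real (inventory S i))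
             \<le> price S i j / c"
    and "\<And>i j. i \<in> {1..items S} \<Longrightarrow> j \<in> {1..num_prices S i} \<Longrightarrow>
           (\<integral>\<omega>. \<Phi> i \<omega> (L i \<omega> j) \<partial>M) \<ge> price S i j"
  shows "achieves_competitive_ratio S (mpb_expected_revenue S M L \<Phi> tie) c"
proof -
  interpret prob_space M using assms(3) by (simp add: mpb_initialization_def)
  have tie: "choice_function (tie \<omega>)" if "\<omega> \<in> space M" for \<omega>
    using assms(4) that by (simp add: tie_breaking_def choice_function_def)
  note real = mpb_initialization_valid_realization[OF assms(3)]
  have "AE \<omega> in M. \<forall>i\<in>{1..items S}. \<forall>j\<in>{1..num_prices S i}. \<forall>N::nat.
             real N \<le> L i \<omega> j * real (inventory S i) - 1 \<longrightarrow>
             real (inventory S i) *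
                 (\<Phi> i \<omega> (real (N + 1) / real (inventory S i)) -
                  \<Phi> i \<omega> (real N / real (inventory S i)))
               + \<Phi> i \<omega> (L i \<omega> j) - \<Phi> i \<omega> (real N / real (inventory S i))
             \<le> price S i j / c"
    by (rule AE_finite_allI[OF finite_atLeastAtMost assms(5)])
  then have inc: "AE \<omega> in M. increment_condition S (\<lambda>i. L i \<omega>) (\<lambda>i. \<Phi> i \<omega>) c"
    unfolding increment_condition_def .
  \<comment> \<open>A function that is not integrable has integral \<open>0\<close> by convention,
    which contradicts the lower bound by a positive price.\<close>
  have int: "integrable M (\<lambda>\<omega>. \<Phi> i \<omega> (L i \<omega> j))" if "i \<in> {1..items S}" "j \<in> {1..num_prices S i}" for i j
  proof (rule ccontr)
    assume "\<not> ?thesis"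
    moreover have "0 < price S i j" using assms(2) that by (auto simp: valid_setup_def)
    ultimately show False using assms(6)[OF that] by (simp add: not_integrable_integral_eq)
  qed
  show ?thesis
    unfolding achieves_competitive_ratio_def
  proof (intro allI impI)
    fix A assume A: "valid_arrivals S A"
    let ?T = "customers A"
    let ?\<pi> = "\<lambda>\<omega>. mpb_policy S A (\<lambda>i. L i \<omega>) (\<lambda>i. \<Phi> i \<omega>) (tie \<omega>)"
    let ?E = "\<lambda>\<omega>. measure_pmf.expectation (run A (?\<pi> \<omega>) ?T) (revenue S)"
    have "?E \<in> borel_measurable M"
    proof (rule measurable_expectation_run[where P = "within_inventory S", OF order.refl])
      fix \<omega> t h i j a
      assume \<omega>: "\<omega> \<in> space M" and "t < ?T" "within_inventory S h" "?\<pi> \<omega> (Suc t) h = Some (i, j)"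
      then show "within_inventory S (Some (i, j, a) # h)"
        by (intro within_inventory_Some[OF real[OF \<omega>] assms(2) A _ _ tie[OF \<omega>]]) auto
    qed (auto intro: mpb_policy_measurable[OF assms(3,4)] simp: within_inventory_def)
    then have E: "integrable M ?E"
      using expected_revenue_bounded[OF assms(2) tie]
      by (intro integrable_const_bound[where B = "real ?T * (\<Sum>(i, j)\<in>offers S. price S i j)"]) auto
    \<comment> \<open>Bounding every feasible solution bounds the supremum, so no optimal solution
      has to be exhibited.\<close>
    have le: "lp_objective S A x \<le> (\<integral>\<omega>. ?E \<omega> \<partial>M) / c" if x: "lp_feasible S A x" for x
    proof -
      let ?V = "\<lambda>\<omega>. lp_value S A (\<lambda>i. L i \<omega>) (\<lambda>i. \<Phi> i \<omega>) x ?T"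
      have V: "has_bochner_integral M ?V (\<Sum>t=1..?T. \<Sum>i=1..items S. \<Sum>j=1..num_prices S i.
          accept_prob A t i j * (\<integral>\<omega>. \<Phi> i \<omega> (L i \<omega> j) \<partial>M) * x t i j)"
        unfolding lp_value_def
        by (intro has_bochner_integral_sum has_bochner_integral_mult_left has_bochner_integral_mult_right
            has_bochner_integral_integrable int)
      have "lp_objective S A x \<le> (\<Sum>t=1..?T. \<Sum>i=1..items S. \<Sum>j=1..num_prices S i.
          accept_prob A t i j * (\<integral>\<omega>. \<Phi> i \<omega> (L i \<omega> j) \<partial>M) * x t i j)"
        unfolding lp_objective_def
        using x A assms(6)
        by (intro sum_mono mult_right_mono mult_left_mono)
          (force simp: lp_feasible_def valid_arrivals_def offers_def)+
      also have "\<dots> = (\<integral>\<omega>. ?V \<omega> \<partial>M)"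
        using V by (simp add: has_bochner_integral_iff)
      finally have "c * lp_objective S A x \<le> (\<integral>\<omega>. c * ?V \<omega> \<partial>M)"
        using \<open>0 < c\<close> by simp
      also have "\<dots> \<le> (\<integral>\<omega>. ?E \<omega> \<partial>M)"
      proof (rule integral_mono_AE)
        \<comment> \<open>The increment condition holds only almost surely, and the remaining facts
          about a realization only on \<open>space M\<close>, which \<open>AE_space\<close>
          supplies.\<close>
        show "AE \<omega> in M. c * ?V \<omega> \<le> ?E \<omega>"
          using inc AE_space
          by eventually_elim
            (rule lp_value_le_expected_revenue[OF real assms(2) A x _ \<open>0 < c\<close> tie])
      qed (use V E in \<open>auto simp: has_bochner_integral_iff\<close>)
      finally show ?thesis
        using \<open>0 < c\<close> by (simp add: pos_le_divide_eq mult.commute)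
    qed
    \<comment> \<open>A least-upper-bound argument over the reals needs a nonempty feasible
      set.\<close>
    have "lp_feasible S A (\<lambda>_ _ _. 0)" by (simp add: lp_feasible_def)
    then have "OPT S A \<le> (\<integral>\<omega>. ?E \<omega> \<partial>M) / c"
      unfolding OPT_def using le by (intro cSUP_least) auto
    then show "c * OPT S A \<le> mpb_expected_revenue S M L \<Phi> tie A"
      unfolding mpb_expected_revenue_def using \<open>0 < c\<close> by (simp add: pos_le_divide_eq mult.commute)
  qed
qed

end
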